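(* Let $n\in\mathbb{N}$, let $\Omega\subset\mathbb{R}^n$ be open, $p\in(1,+\infty)$, $s\in\left(0,\frac1p\right)$, $m\in[p,+\infty)$, and let $W$ be a potential satisfying the standing assumptions listed in the context and such that, for some $c_2,c_3\in(0,+\infty)$, $$c_3(1-x^2)^m\ge W(x)\ge c_2(1-x^2)^m\qquad\text{for every }x\in(-1,1).$$ Assume that $\{u_\epsilon\}_{\epsilon}\subset X^{s,p}(\Omega)$ satisfies $$\sup_{\epsilon\in(0,1)}\mathcal{F}_{s,\epsilon}^p(u_\epsilon,\Omega)<+\infty.$$ Then there exists a measurable set $E\subset\mathbb{R}^n$ such that, up to a subsequence (as $\epsilon\to0^+$), $$u_\epsilon\to u^*:=\chi_E-\chi_{E^c}\qquad\text{in }L^1_{\mathrm{loc}}(\Omega).$$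
   Context: Standing assumptions on $W$: $W\in C^1([-1,1],[0,+\infty))$ and, for some $\theta\in(-1,1)$, $\lambda\in(0,1]$, $\Lambda\in[1,+\infty)$, $\lambda\chi_{(-\infty,\theta]}(x)|1+x|^m\le W(x)\le\Lambda|1+x|^m$ for every $x\in[-1,1]$; moreover, for some $q\in(0,\theta+1]\cap(0,1)$ and $c_1\in(0,+\infty)$, $c_1|1+x|^{m-1}\le W'(x)$ for every $x\in(-1,-1+q)$. Here $\chi_A$ is the characteristic function of $A$. For measurable $u:\mathbb{R}^n\to\mathbb{R}$, $$\mathcal{K}_s^p(u,\Omega):=\frac12\int_\Omega\int_\Omega\frac{|u(x)-u(y)|^p}{|x-y|^{n+sp}}\,dx\,dy+\int_\Omega\int_{\mathbb{R}^n\setminus\Omega}\frac{|u(x)-u(y)|^p}{|x-y|^{n+sp}}\,dx\,dy,$$ and, for $\epsilon\in(0,1)$, $$\mathcal{F}_{s,\epsilon}^p(u,\Omega):=\mathcal{K}_s^p(u,\Omega)+\epsilon^{-sp}\int_\Omega W(u(x))\,dx.$$ Set $X^{s,p}(\Omega):=\{u:\mathbb{R}^n\to\mathbb{R}\text{ measurable s.t. }\mathcal{K}_s^p(u,\Omega)<+\infty\text{ and }\|u\|_{L^\infty(\mathbb{R}^n)}\le1\}$. *)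

theory Defs
  imports "HOL-Analysis.Analysis" "HOL-Probability.Essential_Supremum"
begin

text \<open>
  The potential is a total function on the reals, but only its restriction to the closed interval
  from -1 to 1 is constrained. Differentiability is relative to that interval, hence
  one-sided at the endpoints.
\<close>

definition standing_potential :: "real \<Rightarrow> (real \<Rightarrow> real) \<Rightarrow> bool" where
  "standing_potential m W \<longleftrightarrow>
    (\<forall>x\<in>{-1..1}. 0 \<le> W x) \<and>
    (\<exists>W'.
      (\<forall>x\<in>{-1..1}. (W has_real_derivative W' x) (at x within {-1..1})) \<and>
      continuous_on {-1..1} W' \<and>
      (\<exists>\<theta>\<in>{-1<..<1}.
        (\<exists>lam\<in>{0<..1}. \<exists>\<Lambda>\<ge>1. \<forall>x\<in>{-1..1}.
            lam * indicator {..\<theta>} x * \<bar>1 + x\<bar> powr m \<le> W x \<and> W x \<le> \<Lambda> * \<bar>1 + x\<bar> powr m) \<and>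
        (\<exists>q\<in>{0<..\<theta> + 1} \<inter> {0<..<1}. \<exists>c\<^sub>1>0. \<forall>x\<in>{-1<..<-1 + q}.
            c\<^sub>1 * \<bar>1 + x\<bar> powr (m - 1) \<le> W' x)))"

definition gagliardo_kernel ::
    "real \<Rightarrow> real \<Rightarrow> (real^'n \<Rightarrow> real) \<Rightarrow> real^'n \<Rightarrow> real^'n \<Rightarrow> real" where
  "gagliardo_kernel s p u x y =
    \<bar>u x - u y\<bar> powr p / norm (x - y) powr (real CARD('n) + s * p)"

text \<open>
  The functionals take values in the extended nonnegative reals, so they are defined, possibly
  infinite, for every measurable function. Measurability is Lebesgue measurability throughout.
\<close>

definition K_energy ::
    "real \<Rightarrow> real \<Rightarrow> (real^'n) set \<Rightarrow> (real^'n \<Rightarrow> real) \<Rightarrow> ennreal" where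
  "K_energy s p \<Omega> u =
    1 / 2 * (\<integral>\<^sup>+y\<in>\<Omega>. (\<integral>\<^sup>+x\<in>\<Omega>. ennreal (gagliardo_kernel s p u x y) \<partial>lebesgue) \<partial>lebesgue)
    + (\<integral>\<^sup>+y\<in>\<Omega>. (\<integral>\<^sup>+x\<in>-\<Omega>. ennreal (gagliardo_kernel s p u x y) \<partial>lebesgue) \<partial>lebesgue)"

definition F_energy ::
    "(real \<Rightarrow> real) \<Rightarrow> real \<Rightarrow> real \<Rightarrow> real \<Rightarrow> (real^'n) set \<Rightarrow> (real^'n \<Rightarrow> real) \<Rightarrow> ennreal" where
  "F_energy W s p \<epsilon> \<Omega> u =
    K_energy s p \<Omega> u + ennreal (\<epsilon> powr (- (s * p))) * (\<integral>\<^sup>+x\<in>\<Omega>. ennreal (W (u x)) \<partial>lebesgue)"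

definition X_space :: "real \<Rightarrow> real \<Rightarrow> (real^'n) set \<Rightarrow> (real^'n \<Rightarrow> real) set" where
  "X_space s p \<Omega> =
    {u \<in> borel_measurable lebesgue.
      K_energy s p \<Omega> u < \<infinity> \<and> esssup lebesgue (\<lambda>x. ereal \<bar>u x\<bar>) \<le> 1}"

definition L1_loc :: "(real^'n) set \<Rightarrow> (real^'n \<Rightarrow> real) set" where
  "L1_loc \<Omega> = {f. \<forall>C. compact C \<and> C \<subseteq> \<Omega> \<longrightarrow> set_integrable lebesgue C f}"

definition tendsto_L1_loc ::
    "(real^'n) set \<Rightarrow> (nat \<Rightarrow> real^'n \<Rightarrow> real) \<Rightarrow> (real^'n \<Rightarrow> real) \<Rightarrow> bool" where
  "tendsto_L1_loc \<Omega> f g \<longleftrightarrow>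
    (\<forall>k. f k \<in> L1_loc \<Omega>) \<and> g \<in> L1_loc \<Omega> \<and>
    (\<forall>C. compact C \<and> C \<subseteq> \<Omega> \<longrightarrow> (\<lambda>k. LINT x:C|lebesgue. \<bar>f k x - g x\<bar>) \<longlonglongrightarrow> 0)"

end

theory Submission
  imports Defs "HOL-Complex_Analysis.Great_Picard"
begin

text \<open>
  On a cube of side \<open>1/N\<close> inside \<open>\<Omega>\<close> the inequality \<open>a \<le> \<delta> + \<delta>\<^bsup>1-p\<^esup> a\<^sup>p\<close> bounds the mean
  oscillation of a function by \<open>\<delta>\<close> plus its Gagliardo energy, and after summation over cubes the
  energy term carries a factor \<open>N powr (- s p)\<close>. Functions of bounded energy are thus uniformly
  \<open>L\<^sup>1\<close>-close to their averages over a fine grid. These take countably many values, so along a diagonal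
  subsequence they all converge, the functions become Cauchy in \<open>L\<^sup>1\<close> on compact subsets, and a further
  subsequence converges almost everywhere in \<open>\<Omega>\<close>. The potential energy tends to zero, which forces
  the limit into the zero set of \<open>1 - x\<^sup>2\<close>.
\<close>

section \<open>Lebesgue measure as a completed measure\<close>

text \<open>Makes the coordinates in \<open>norm (x - y)\<close> Lebesgue measurable, as needed for
  the kernel on the product space.\<close>

lemma borel_measurable_lebesgue_ident [measurable]:
  "(\<lambda>x. x) \<in> borel_measurable (lebesgue :: (real^'n) measure)"
  by (intro measurable_completion) simp

text \<open>A countable cover by sets of finite \<open>lborel\<close> measure still works, because
  completion leaves the measure of Borel sets unchanged. Sigma-finiteness makes the inner integral
  of the kernel a measurable function of the outer variable.\<close>

lemma sigma_finite_lebesgue: "sigma_finite_measure (lebesgue :: (real^'n) measure)"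
proof
  obtain A :: "(real^'n) set set" where A: "countable A" "A \<subseteq> sets lborel" "\<Union>A = space lborel"
      "\<forall>a\<in>A. emeasure lborel a \<noteq> \<infinity>"
    using lborel.sigma_finite_countable by blast
  have "\<forall>a\<in>A. emeasure lebesgue a \<noteq> \<infinity>"
    using A by auto
  with A show "\<exists>A. countable A \<and> A \<subseteq> sets (lebesgue :: (real^'n) measure)
      \<and> \<Union> A = space lebesgue \<and> (\<forall>a\<in>A. emeasure lebesgue a \<noteq> \<infinity>)"
    by (intro exI[of _ A]) auto
qed

section \<open>The grid of cubes of side \<open>1/N\<close> and averages over it\<close>

text \<open>The floor makes the cubes half-open, so for fixed \<open>N\<close> every point lies in
  exactly one of them.\<close>

definition grid_cube :: "nat \<Rightarrow> int^'n \<Rightarrow> (real^'n) set" where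
  "grid_cube N z = {y. \<forall>i. \<lfloor>real N * y $ i\<rfloor> = z $ i}"

definition grid_index :: "nat \<Rightarrow> real^'n \<Rightarrow> int^'n" where
  "grid_index N x = (\<chi> i. \<lfloor>real N * x $ i\<rfloor>)"

text \<open>For \<open>N > 0\<close> the prefactor is the reciprocal of the volume of the cube, so
  this is a mean value. For \<open>N = 0\<close> the prefactor vanishes and the value is
  \<open>0\<close>.\<close>

definition cube_average :: "nat \<Rightarrow> (real^'n \<Rightarrow> real) \<Rightarrow> int^'n \<Rightarrow> real" where
  "cube_average N v z = real N ^ CARD('n) * (LINT y:grid_cube N z|lebesgue. v y)"

lemma in_grid_cube_iff: "y \<in> grid_cube N z \<longleftrightarrow> grid_index N y = z"
  by (auto simp: grid_cube_def grid_index_def vec_eq_iff)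

lemma grid_cube_borel [simp]: "grid_cube N (z :: int^'n) \<in> sets borel"
proof -
  have "{y :: real^'n. \<lfloor>real N * y $ i\<rfloor> = z $ i} \<in> sets borel" for i
  proof -
    have "{y :: real^'n. \<lfloor>real N * y $ i\<rfloor> = z $ i}
        = {y. of_int (z $ i) \<le> real N * y $ i} \<inter> {y. real N * y $ i < of_int (z $ i) + 1}"
      by (auto simp: floor_eq_iff)
    moreover have "closed {y :: real^'n. of_int (z $ i) \<le> real N * y $ i}"
      by (intro closed_Collect_le continuous_intros)
    moreover have "open {y :: real^'n. real N * y $ i < of_int (z $ i) + 1}"
      by (intro open_Collect_less continuous_intros)
    ultimately show ?thesis
      by auto
  qed
  then have "(\<Inter>i. {y :: real^'n. \<lfloor>real N * y $ i\<rfloor> = z $ i}) \<in> sets borel"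
    by (intro sets.finite_INT) auto
  moreover have "(\<Inter>i. {y :: real^'n. \<lfloor>real N * y $ i\<rfloor> = z $ i}) = grid_cube N z"
    by (auto simp: grid_cube_def)
  ultimately show ?thesis
    by simp
qed

text \<open>The index set is countable, so measurability of the single cubes suffices. As a
  consequence, every function that is constant on each cube is measurable, whatever its
  values.\<close>

lemma measurable_grid_index [measurable]:
  "grid_index N \<in> measurable lebesgue (count_space (UNIV :: (int^'n) set))"
proof -
  have "grid_index N -` {z} \<inter> space lebesgue = grid_cube N z" for z :: "int^'n"
    by (auto simp: in_grid_cube_iff)
  moreover have "grid_cube N z \<in> sets lebesgue" for z :: "int^'n"
    by auto
  ultimately show ?thesis
    by (subst measurable_count_space_eq2_countable) auto
qed

text \<open>The half-open cube lies between an open and a closed box with the same corners, and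
  these have equal measure.\<close>

lemma emeasure_grid_cube:
  assumes "N > 0"
  shows "emeasure lebesgue (grid_cube N (z :: int^'n)) = ennreal ((1 / real N) ^ CARD('n))"
proof -
  define a b :: "real^'n" where "a = (\<chi> i. of_int (z $ i) / N)" and "b = (\<chi> i. (of_int (z $ i) + 1) / N)"
  have N: "real N > 0" using assms by simp
  have le: "\<forall>i. a $ i \<le> b $ i"
    using N by (auto simp: a_def b_def divide_right_mono)
  have prod: "measure lborel (cbox a b) = (1 / real N) ^ CARD('n)"
  proof -
    have "cbox a b \<noteq> {}" using le by (simp add: interval_ne_empty_cart)
    then have "measure lborel (cbox a b) = (\<Prod>i\<in>UNIV. b $ i - a $ i)"
      by (rule content_cbox_cart)
    also have "\<dots> = (\<Prod>i\<in>(UNIV::'n set). 1 / real N)"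
      using N by (intro prod.cong) (auto simp: a_def b_def diff_divide_distrib[symmetric])
    finally show ?thesis by simp
  qed
  have sub1: "box a b \<subseteq> grid_cube N z" and sub2: "grid_cube N z \<subseteq> cbox a b"
    using N by (auto simp: grid_cube_def a_def b_def mem_box_cart floor_eq_iff field_simps less_imp_le)
  have bb: "emeasure lborel (box a b) = emeasure lborel (cbox a b)"
    by (simp add: emeasure_lborel_box_eq emeasure_lborel_cbox_eq)
  have "emeasure lborel (grid_cube N z) = emeasure lborel (cbox a b)"
    using emeasure_mono[OF sub2, of lborel] emeasure_mono[OF sub1, of lborel] bb by simp
  also have "\<dots> = ennreal ((1 / real N) ^ CARD('n))"
    using prod by (metis emeasure_eq_ennreal_measure emeasure_lborel_cbox_finite less_top top.not_eq_extremum infinity_ennreal_def)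
  finally show ?thesis
    by simp
qed

text \<open>Coordinates differ by at most \<open>1/N\<close>, and the norm is bounded by the sum of
  the coordinates. Only the decay in \<open>N\<close> matters later, so this crude constant is
  enough.\<close>

lemma norm_diff_grid_cube:
  assumes "N > 0" "grid_index N x = grid_index N (y :: real^'n)"
  shows "norm (x - y) \<le> real CARD('n) / real N"
proof -
  have "\<bar>x $ i - y $ i\<bar> \<le> 1 / real N" for i
  proof -
    have "\<lfloor>real N * x $ i\<rfloor> = \<lfloor>real N * y $ i\<rfloor>"
      using assms(2) by (simp add: grid_index_def vec_eq_iff)
    then have "\<bar>real N * x $ i - real N * y $ i\<bar> \<le> 1"
      by linarith
    then have "real N * \<bar>x $ i - y $ i\<bar> \<le> 1"
      by (simp add: abs_mult flip: right_diff_distrib)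
    then show ?thesis using assms(1) by (simp add: field_simps)
  qed
  then have "(\<Sum>i\<in>UNIV. \<bar>(x - y) $ i\<bar>) \<le> (\<Sum>i\<in>(UNIV::'n set). 1 / real N)"
    by (intro sum_mono) simp
  then show ?thesis
    using norm_le_l1_cart[of "x - y"] by simp
qed

section \<open>Oscillation on cubes bounded by the Gagliardo kernel\<close>

lemma gagliardo_kernel_nonneg: "0 \<le> gagliardo_kernel s p v x y"
  by (simp add: gagliardo_kernel_def)

lemma borel_measurable_gagliardo_kernel:
  fixes v :: "real^'n \<Rightarrow> real"
  assumes [measurable]: "v \<in> borel_measurable lebesgue"
  shows "(\<lambda>(y, x). gagliardo_kernel s p v x y) \<in> borel_measurable (lebesgue \<Otimes>\<^sub>M lebesgue)"
  unfolding gagliardo_kernel_def by measurable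

text \<open>Let \<open>a\<close> be the left-hand side. If \<open>a\<close> exceeds \<delta>, then
  \<open>a = a powr (1 - p) * a powr p\<close> is at most
  \<open>\<delta> powr (1 - p) * a powr p\<close>, since the exponent \<open>1 - p\<close> is
  negative; and \<open>a powr p\<close> is the kernel times a power of the distance. This takes the
  place of Hoelder's inequality.\<close>

lemma abs_diff_le_gagliardo_kernel:
  fixes v :: "real^'n \<Rightarrow> real"
  assumes "0 < \<delta>" "1 < p" "0 < s" "norm (x - y) \<le> d"
  shows "\<bar>v x - v y\<bar> \<le> \<delta> + \<delta> powr (1 - p) * d powr (real CARD('n) + s * p) * gagliardo_kernel s p v x y"
proof (cases "\<bar>v x - v y\<bar> \<le> \<delta>")
  case True
  then show ?thesis
    by (smt (verit) gagliardo_kernel_nonneg mult_nonneg_nonneg powr_ge_zero)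
next
  case False
  define a where "a = \<bar>v x - v y\<bar>"
  have a: "a > \<delta>" using False by (simp add: a_def)
  \<comment> \<open>Equal points would give difference \<open>0\<close>, which is below \<delta>; so
    the denominator of the kernel is not zero.\<close>
  have ne: "norm (x - y) > 0" using False assms by auto
  let ?e = "real CARD('n) + s * p"
  have "a powr p = norm (x - y) powr ?e * gagliardo_kernel s p v x y"
    using ne by (simp add: gagliardo_kernel_def a_def)
  also have "\<dots> \<le> d powr ?e * gagliardo_kernel s p v x y"
    using assms by (intro mult_right_mono powr_mono2 gagliardo_kernel_nonneg) auto
  finally have 1: "a powr p \<le> d powr ?e * gagliardo_kernel s p v x y" .
  have "a = a powr (1 - p) * a powr p"
    using a assms by (simp flip: powr_add)
  also have "\<dots> \<le> \<delta> powr (1 - p) * a powr p"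
    using a assms by (intro mult_right_mono powr_mono2') auto
  also have "\<dots> \<le> \<delta> powr (1 - p) * (d powr ?e * gagliardo_kernel s p v x y)"
    using 1 by (intro mult_left_mono) auto
  finally show ?thesis
    using assms by (simp add: a_def mult.assoc)
qed

lemma set_integrable_lebesgue_bounded:
  fixes v :: "real^'n \<Rightarrow> real"
  assumes "v \<in> borel_measurable lebesgue" "AE x in lebesgue. \<bar>v x\<bar> \<le> B"
    and "A \<in> sets lebesgue" "emeasure lebesgue A < \<infinity>"
  shows "set_integrable lebesgue A v"
  using assms unfolding set_integrable_def
  by (intro integrableI_bounded_set_indicator[where B = B]) auto

text \<open>The constant \<open>v x\<close> is its own mean over the cube, so the difference is the
  mean of \<open>v x - v y\<close>, and the absolute value passes under the integral. The point
  \<open>x\<close> need not lie in the cube.\<close>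

lemma abs_diff_cube_average_le:
  fixes v :: "real^'n \<Rightarrow> real"
  assumes v [measurable]: "v \<in> borel_measurable lebesgue" and bdd: "\<And>x. \<bar>v x\<bar> \<le> 1" and "N > 0"
  shows "ennreal \<bar>v x - cube_average N v z\<bar>
    \<le> ennreal (real N ^ CARD('n)) * (\<integral>\<^sup>+y\<in>grid_cube N z. ennreal \<bar>v x - v y\<bar> \<partial>lebesgue)"
proof -
  let ?Q = "grid_cube N z"
  have Q: "?Q \<in> sets lebesgue" "emeasure lebesgue ?Q < \<infinity>"
    using emeasure_grid_cube[OF \<open>N > 0\<close>, of z] by auto
  have int: "set_integrable lebesgue ?Q v" 
    by (rule set_integrable_lebesgue_bounded[where B = 1]) (use bdd Q in auto)
  have intc: "set_integrable lebesgue ?Q (\<lambda>_. c :: real)" for c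
    by (rule set_integrable_lebesgue_bounded[where B = "\<bar>c\<bar>"]) (use Q in auto)
  have meas: "measure lebesgue ?Q = (1 / real N) ^ CARD('n)"
    using emeasure_grid_cube[OF \<open>N > 0\<close>, of z] by (simp add: measure_def)
  have "(LINT y:?Q|lebesgue. v x) = measure lebesgue ?Q * v x"
    using Q by (subst set_integral_const) auto
  then have "v x = real N ^ CARD('n) * (LINT y:?Q|lebesgue. v x)"
    using \<open>N > 0\<close> by (simp add: meas field_simps)
  then have "v x - cube_average N v z = real N ^ CARD('n) * (LINT y:?Q|lebesgue. v x - v y)"
    using set_integral_diff(2)[OF intc[of "v x"] int] by (simp add: cube_average_def right_diff_distrib)
  then have "ennreal \<bar>v x - cube_average N v z\<bar>
      = ennreal (real N ^ CARD('n)) * ennreal (norm (LINT y:?Q|lebesgue. v x - v y))"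
    by (simp add: abs_mult ennreal_mult)
  also have "ennreal (norm (LINT y:?Q|lebesgue. v x - v y))
      \<le> (\<integral>\<^sup>+y. ennreal (norm (indicator ?Q y *\<^sub>R (v x - v y))) \<partial>lebesgue)"
    unfolding set_lebesgue_integral_def
    by (rule integral_norm_bound_ennreal) (use set_integral_diff(1)[OF intc[of "v x"] int] in \<open>simp add: set_integrable_def\<close>)
  also have "\<dots> = (\<integral>\<^sup>+y\<in>?Q. ennreal \<bar>v x - v y\<bar> \<partial>lebesgue)"
    by (intro nn_integral_cong) (auto simp: indicator_def)
  finally show ?thesis
    by (simp add: mult_left_mono)
qed

text \<open>The estimate is made at each point \<open>y\<close> of \<open>K\<close>, with the cube
  containing \<open>y\<close>. Since that cube lies in \<Omega>, its part of the kernel integral is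
  at most the one over all of \<Omega>, and integrating in \<open>y\<close> yields the energy
  without an explicit sum over cubes.\<close>

lemma L1_dist_cube_average_le:
  fixes v :: "real^'n \<Rightarrow> real"
  assumes v [measurable]: "v \<in> borel_measurable lebesgue" and bdd: "\<And>x. \<bar>v x\<bar> \<le> 1" and N: "N > 0"
    and [measurable]: "K \<in> sets lebesgue" "\<Omega> \<in> sets lebesgue"
    and sub: "K \<subseteq> \<Omega>" "\<And>x. x \<in> K \<Longrightarrow> grid_cube N (grid_index N x) \<subseteq> \<Omega>"
    and "0 < \<delta>" "1 < p" "0 < s"
  shows "(\<integral>\<^sup>+x\<in>K. ennreal \<bar>v x - cube_average N v (grid_index N x)\<bar> \<partial>lebesgue)
    \<le> ennreal \<delta> * emeasure lebesgue K
      + ennreal (\<delta> powr (1 - p) * real CARD('n) powr (real CARD('n) + s * p) * real N powr (- (s * p)))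
        * (\<integral>\<^sup>+y\<in>\<Omega>. (\<integral>\<^sup>+x\<in>\<Omega>. ennreal (gagliardo_kernel s p v x y) \<partial>lebesgue) \<partial>lebesgue)"
proof -
  interpret sigma_finite_measure "lebesgue :: (real^'n) measure" by (rule sigma_finite_lebesgue)
  let ?n = "CARD('n)"
  let ?e = "real ?n + s * p"
  define c where "c = \<delta> powr (1 - p) * (real ?n / real N) powr ?e"
  define G where "G y = (\<integral>\<^sup>+x\<in>\<Omega>. ennreal (gagliardo_kernel s p v x y) \<partial>lebesgue)" for y
  have c: "c \<ge> 0" by (simp add: c_def)
  note [measurable] = borel_measurable_gagliardo_kernel[OF v, of s p]
  have Gm [measurable]: "G \<in> borel_measurable lebesgue"
    unfolding G_def by measurable
  have ker [measurable]: "(\<lambda>x. gagliardo_kernel s p v x y) \<in> borel_measurable lebesgue" for y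
    unfolding gagliardo_kernel_def by measurable
  \<comment> \<open>The factor \<open>N ^ n\<close> from the mean cancels all of the kernel's power
    of \<open>1/N\<close> except \<open>N powr (- (s * p))\<close>, which is the source of the
    decay.\<close>
  have const: "real N ^ ?n * c = \<delta> powr (1 - p) * real ?n powr ?e * real N powr (- (s * p))"
  proof -
    have "real N ^ ?n * (real ?n / real N) powr ?e = real ?n powr ?e * (real N powr real ?n / real N powr ?e)"
      using N by (simp add: powr_divide powr_realpow)
    also have "real N powr real ?n / real N powr ?e = real N powr (- (s * p))"
      by (simp flip: powr_diff)
    finally show ?thesis by (simp add: c_def mult_ac)
  qed
  have pt: "ennreal \<bar>v y - cube_average N v (grid_index N y)\<bar>
      \<le> ennreal \<delta> + ennreal (real N ^ ?n * c) * G y" if "y \<in> K" for y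
  proof -
    let ?Q = "grid_cube N (grid_index N y)"
    have Q [measurable]: "?Q \<in> sets lebesgue"
      by auto
    \<comment> \<open>Inside the cube the kernel bound applies with \<open>d = n / N\<close>;
      outside it the left integrand is \<open>0\<close>, so the kernel term may be extended to
      \<Omega>.\<close>
    have "(\<integral>\<^sup>+x\<in>?Q. ennreal \<bar>v y - v x\<bar> \<partial>lebesgue)
        \<le> (\<integral>\<^sup>+x. ennreal \<delta> * indicator ?Q x + ennreal c * (ennreal (gagliardo_kernel s p v x y) * indicator \<Omega> x) \<partial>lebesgue)"
    proof (rule nn_integral_mono)
      fix x
      show "ennreal \<bar>v y - v x\<bar> * indicator ?Q x
        \<le> ennreal \<delta> * indicator ?Q x + ennreal c * (ennreal (gagliardo_kernel s p v x y) * indicator \<Omega> x)"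
      proof (cases "x \<in> ?Q")
        case True
        then have "norm (x - y) \<le> real ?n / real N"
          using norm_diff_grid_cube[OF N] by (simp add: in_grid_cube_iff)
        from abs_diff_le_gagliardo_kernel[OF \<open>0 < \<delta>\<close> \<open>1 < p\<close> \<open>0 < s\<close> this, of v]
        have "\<bar>v y - v x\<bar> \<le> \<delta> + c * gagliardo_kernel s p v x y"
          by (simp add: c_def abs_minus_commute)
        then have "ennreal \<bar>v y - v x\<bar> \<le> ennreal (\<delta> + c * gagliardo_kernel s p v x y)"
          by (rule ennreal_leI)
        also have "\<dots> = ennreal \<delta> + ennreal c * ennreal (gagliardo_kernel s p v x y)"
          using \<open>0 < \<delta>\<close> c gagliardo_kernel_nonneg[of s p v x y] by (simp add: ennreal_plus ennreal_mult)
        finally show ?thesis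
          using True sub(2)[OF that] by (auto simp: indicator_def)
      qed simp
    qed
    also have "\<dots> = ennreal \<delta> * emeasure lebesgue ?Q + ennreal c * G y"
      by (simp add: nn_integral_add nn_integral_cmult nn_integral_cmult_indicator G_def)
    finally have le: "(\<integral>\<^sup>+x\<in>?Q. ennreal \<bar>v y - v x\<bar> \<partial>lebesgue)
        \<le> ennreal \<delta> * ennreal ((1 / real N) ^ ?n) + ennreal c * G y"
      by (simp add: emeasure_grid_cube[OF N])
    have "ennreal \<bar>v y - cube_average N v (grid_index N y)\<bar>
        \<le> ennreal (real N ^ ?n) * (ennreal \<delta> * ennreal ((1 / real N) ^ ?n) + ennreal c * G y)"
      by (rule order_trans[OF abs_diff_cube_average_le[OF v bdd N] mult_left_mono[OF le]]) simp
    also have "\<dots> = ennreal (real N ^ ?n * (\<delta> * (1 / real N) ^ ?n)) + ennreal (real N ^ ?n * c) * G y"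
      using \<open>0 < \<delta>\<close> c by (simp add: distrib_left ennreal_mult mult.assoc)
    also have "real N ^ ?n * (\<delta> * (1 / real N) ^ ?n) = \<delta>"
      using N by (simp add: field_simps)
    finally show ?thesis .
  qed
  have "(\<integral>\<^sup>+x\<in>K. ennreal \<bar>v x - cube_average N v (grid_index N x)\<bar> \<partial>lebesgue)
      \<le> (\<integral>\<^sup>+y. ennreal \<delta> * indicator K y + ennreal (real N ^ ?n * c) * (G y * indicator \<Omega> y) \<partial>lebesgue)"
  proof (rule nn_integral_mono)
    fix x
    show "ennreal \<bar>v x - cube_average N v (grid_index N x)\<bar> * indicator K x
        \<le> ennreal \<delta> * indicator K x + ennreal (real N ^ ?n * c) * (G x * indicator \<Omega> x)"
      using pt[of x] sub(1) by (cases "x \<in> K") auto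
  qed
  also have "\<dots> = ennreal \<delta> * emeasure lebesgue K + ennreal (real N ^ ?n * c) * (\<integral>\<^sup>+y\<in>\<Omega>. G y \<partial>lebesgue)"
    by (simp add: nn_integral_add nn_integral_cmult nn_integral_cmult_indicator)
  finally show ?thesis
    unfolding const G_def .
qed

section \<open>Almost everywhere convergence along subsequences\<close>

text \<open>The integral of the sum is the sum of the integrals, hence finite, so the sum is finite
  almost everywhere. It serves both for increments of a fast subsequence and for the potential
  energies.\<close>

lemma AE_summable_of_nn_integral_le:
  fixes f :: "nat \<Rightarrow> 'a \<Rightarrow> real"
  assumes [measurable]: "\<And>k. f k \<in> borel_measurable M" and nonneg: "\<And>k x. 0 \<le> f k x"
    and le: "\<And>k. (\<integral>\<^sup>+x. ennreal (f k x) \<partial>M) \<le> ennreal (c k)"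
    and c: "summable c" "\<And>k. 0 \<le> c k"
  shows "AE x in M. summable (\<lambda>k. f k x)"
proof -
  have "(\<integral>\<^sup>+x. (\<Sum>k. ennreal (f k x)) \<partial>M) = (\<Sum>k. \<integral>\<^sup>+x. ennreal (f k x) \<partial>M)"
    by (rule nn_integral_suminf) simp
  also have "\<dots> \<le> (\<Sum>k. ennreal (c k))"
    using le by (intro suminf_le) auto
  also have "\<dots> = ennreal (suminf c)"
    using c by (intro suminf_ennreal2) auto
  finally have "(\<integral>\<^sup>+x. (\<Sum>k. ennreal (f k x)) \<partial>M) \<noteq> \<infinity>"
    by (auto simp: top_unique)
  then have "AE x in M. (\<Sum>k. ennreal (f k x)) \<noteq> \<infinity>"
    by (intro nn_integral_noteq_infinite) auto
  then show ?thesis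
    by eventually_elim (use nonneg in \<open>auto intro: summable_suminf_not_top\<close>)
qed

text \<open>A subsequence whose consecutive distances decay geometrically has summable increments
  almost everywhere. One subsequence serves all the sets \<open>K j\<close>, because step
  \<open>i\<close> only has to respect the first \<open>i + 1\<close> of them.\<close>

lemma AE_convergent_subseq_of_L1_Cauchy:
  fixes f :: "nat \<Rightarrow> 'a \<Rightarrow> real" and K :: "nat \<Rightarrow> 'a set"
  assumes [measurable]: "\<And>k. f k \<in> borel_measurable M" "\<And>j. K j \<in> sets M"
    and Cauchy: "\<And>j e. 0 < e \<Longrightarrow>
      \<exists>n. \<forall>k\<ge>n. \<forall>l\<ge>n. (\<integral>\<^sup>+x\<in>K j. ennreal \<bar>f k x - f l x\<bar> \<partial>M) \<le> ennreal e"
  obtains r :: "nat \<Rightarrow> nat" where "strict_mono r"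
    and "AE x in M. x \<in> (\<Union>j. K j) \<longrightarrow> convergent (\<lambda>k. f (r k) x)"
proof -
  define P where "P i j n \<longleftrightarrow>
    (\<forall>k\<ge>n. \<forall>l\<ge>n. (\<integral>\<^sup>+x\<in>K j. ennreal \<bar>f k x - f l x\<bar> \<partial>M) \<le> ennreal ((1/2) ^ i))" for i j n
  define b where "b i j = (SOME n. P i j n)" for i j
  have "P i j (b i j)" for i j
    unfolding b_def by (rule someI_ex) (use Cauchy[of "(1/2) ^ i" j] in \<open>simp add: P_def\<close>)
  then have b: "(\<integral>\<^sup>+x\<in>K j. ennreal \<bar>f k x - f l x\<bar> \<partial>M) \<le> ennreal ((1/2) ^ i)"
    if "b i j \<le> k" "b i j \<le> l" for i j k l
    using that by (simp add: P_def)
  \<comment> \<open>The sum is a convenient upper bound for the finitely many thresholds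
    \<open>b i j\<close> with \<open>j \<le> i\<close>. Adding \<open>B (Suc i)\<close> and a
    successor in the recursion makes \<open>r\<close> both strictly increasing and at least
    \<open>B\<close>.\<close>
  define B where "B i = (\<Sum>j\<le>i. b i j)" for i
  define r where "r = rec_nat (B 0) (\<lambda>i m. Suc m + B (Suc i))"
  have r_Suc: "r (Suc i) = Suc (r i) + B (Suc i)" for i
    by (simp add: r_def)
  have mono: "strict_mono r"
    by (simp add: strict_mono_Suc_iff r_Suc)
  have rB: "B i \<le> r i" for i
    by (cases i) (simp_all add: r_def)
  have rb: "b i j \<le> r i" if "j \<le> i" for i j
    using rB[of i] member_le_sum[of j "{..i}" "b i"] that by (simp add: B_def)
  have conv: "AE x in M. x \<in> K j \<longrightarrow> convergent (\<lambda>k. f (r k) x)" for j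
  proof -
    \<comment> \<open>The shift by \<open>j\<close> is needed because \<open>b i j \<le> r i\<close>
      is known only for \<open>j \<le> i\<close>.\<close>
    define g where "g k x = \<bar>f (r (Suc (k + j))) x - f (r (k + j)) x\<bar> * indicator (K j) x" for k x
    have [measurable]: "g k \<in> borel_measurable M" for k
      unfolding g_def by measurable
    have "AE x in M. summable (\<lambda>k. g k x)"
    proof (rule AE_summable_of_nn_integral_le)
      fix k
      have "(\<integral>\<^sup>+x. ennreal (g k x) \<partial>M)
          = (\<integral>\<^sup>+x\<in>K j. ennreal \<bar>f (r (Suc (k + j))) x - f (r (k + j)) x\<bar> \<partial>M)"
        by (intro nn_integral_cong) (auto simp: g_def indicator_def)
      also have "\<dots> \<le> ennreal ((1/2) ^ (k + j))"
      proof (rule b)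
        show "b (k + j) j \<le> r (k + j)" by (simp add: rb)
        then show "b (k + j) j \<le> r (Suc (k + j))" by (simp add: r_Suc)
      qed
      finally show "(\<integral>\<^sup>+x. ennreal (g k x) \<partial>M) \<le> ennreal ((1/2) ^ (k + j))" .
    next
      show "summable (\<lambda>k. (1/2::real) ^ (k + j))"
        by (simp only: summable_iff_shift) (simp add: summable_geometric)
    qed (auto simp: g_def)
    then show ?thesis
    proof eventually_elim
      case (elim x)
      show ?case
      proof
        assume "x \<in> K j"
        define h where "h k = f (r (k + j)) x" for k
        have "summable (\<lambda>k. \<bar>h (Suc k) - h k\<bar>)"
          using elim \<open>x \<in> K j\<close> by (simp add: g_def h_def)
        then have "summable (\<lambda>k. h (Suc k) - h k)"
          by (rule summable_rabs_cancel)
        then have "convergent (\<lambda>n. h n - h 0)"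
          by (simp add: summable_iff_convergent sum_lessThan_telescope)
        then have "convergent (\<lambda>n. (h n - h 0) + h 0)"
          by (intro convergent_add convergent_const)
        then show "convergent (\<lambda>k. f (r k) x)"
          using convergent_ignore_initial_segment[of "\<lambda>k. f (r k) x" j] by (simp add: h_def)
      qed
    qed
  qed
  have "AE x in M. \<forall>j. x \<in> K j \<longrightarrow> convergent (\<lambda>k. f (r k) x)"
    unfolding AE_all_countable using conv by blast
  then have "AE x in M. x \<in> (\<Union>j. K j) \<longrightarrow> convergent (\<lambda>k. f (r k) x)"
    by eventually_elim auto
  with mono show thesis
    by (rule that)
qed

section \<open>Compactness of sequences with bounded energy\<close>

text \<open>The case \<open>N = 0\<close> is covered by the default value \<open>0\<close>, so the
  extraction of convergent averages may range over all pairs of a mesh and an index.\<close>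

lemma abs_cube_average_le:
  fixes v :: "real^'n \<Rightarrow> real"
  assumes v: "v \<in> borel_measurable lebesgue" and bdd: "\<And>x. \<bar>v x\<bar> \<le> 1"
  shows "\<bar>cube_average N v z\<bar> \<le> 1"
proof (cases "N = 0")
  case False
  let ?Q = "grid_cube N z"
  have Q: "?Q \<in> sets lebesgue" "emeasure lebesgue ?Q < \<infinity>" and meas: "measure lebesgue ?Q = (1 / real N) ^ CARD('n)"
    using emeasure_grid_cube[of N z] False by (auto simp: measure_def)
  have int: "set_integrable lebesgue ?Q v"
    by (rule set_integrable_lebesgue_bounded[where B = 1]) (use v bdd Q in auto)
  have intc: "set_integrable lebesgue ?Q (\<lambda>_. c :: real)" for c
    by (rule set_integrable_lebesgue_bounded[where B = "\<bar>c\<bar>"]) (use Q in auto)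
  have const: "(LINT y:?Q|lebesgue. c) = (1 / real N) ^ CARD('n) * c" for c :: real
    using Q meas by (subst set_integral_const) auto
  have v1: "- 1 \<le> v y" "v y \<le> 1" for y
    using bdd[of y] by auto
  have "(LINT y:?Q|lebesgue. v y) \<le> (1 / real N) ^ CARD('n)"
       "- ((1 / real N) ^ CARD('n)) \<le> (LINT y:?Q|lebesgue. v y)"
    using set_integral_mono[OF int intc[of 1]] set_integral_mono[OF intc[of "-1"] int] v1
    unfolding const by auto
  then have "\<bar>LINT y:?Q|lebesgue. v y\<bar> \<le> (1 / real N) ^ CARD('n)"
    by linarith
  then show ?thesis
    using False by (simp add: cube_average_def abs_mult field_simps)
qed (simp add: cube_average_def power_0_left)

text \<open>On one fixed fine grid, \<open>v k - v l\<close> is split through the averages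
  \<open>A k\<close>, \<open>A l\<close> and their limit \<alpha>. Each of the four pieces
  contributes at most \<open>e / 4\<close>: two by the oscillation estimate, uniformly in the
  sequence, and two by convergence of the averages.\<close>

lemma L1_Cauchy_of_bounded_energy:
  fixes v :: "nat \<Rightarrow> real^'n \<Rightarrow> real"
  assumes v [measurable]: "\<And>k. v k \<in> borel_measurable lebesgue" and bdd: "\<And>k x. \<bar>v k x\<bar> \<le> 1"
    and "open \<Omega>" "compact K" "K \<subseteq> \<Omega>" "1 < p" "0 < s" "0 \<le> C"
    and energy: "\<And>k. (\<integral>\<^sup>+y\<in>\<Omega>. (\<integral>\<^sup>+x\<in>\<Omega>. ennreal (gagliardo_kernel s p (v k) x y) \<partial>lebesgue) \<partial>lebesgue) \<le> ennreal C"
    and conv: "\<And>N z. convergent (\<lambda>k. cube_average N (v k) z)"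
    and "0 < e"
  shows "\<exists>n. \<forall>k\<ge>n. \<forall>l\<ge>n. (\<integral>\<^sup>+x\<in>K. ennreal \<bar>v k x - v l x\<bar> \<partial>lebesgue) \<le> ennreal e"
proof -
  have K [measurable]: "K \<in> sets lebesgue" and \<Omega>: "\<Omega> \<in> sets lebesgue"
    using \<open>compact K\<close> \<open>open \<Omega>\<close> by (auto intro: fmeasurableD[OF lmeasurable_compact])
  define \<mu> where "\<mu> = measure lebesgue K"
  have emK: "emeasure lebesgue K = ennreal \<mu>"
    using \<open>compact K\<close> emeasure_compact_finite[of K]
    by (simp add: \<mu>_def emeasure_eq_ennreal_measure borel_compact less_top)
  have \<mu>: "\<mu> \<ge> 0" by (simp add: \<mu>_def)
  \<comment> \<open>This keeps the \<delta> term below \<open>e / 8\<close>, with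
    \<open>\<mu> + 1\<close> guarding against measure zero. Once \<delta> is fixed, \<open>N\<close>
    is taken so large that the energy term is below \<open>e / 8\<close> as well.\<close>
  define \<delta> where "\<delta> = e / (8 * (\<mu> + 1))"
  have \<delta>: "0 < \<delta>" "\<delta> * \<mu> \<le> e / 8"
    using \<mu> \<open>0 < e\<close> by (auto simp: \<delta>_def field_simps)
  define D where "D = \<delta> powr (1 - p) * real CARD('n) powr (real CARD('n) + s * p)"
  have D: "D \<ge> 0" by (simp add: D_def)
  \<comment> \<open>With cube diameters below \<rho>, every cube that meets \<open>K\<close> stays
    inside \<Omega>.\<close>
  obtain \<rho> where \<rho>: "\<rho> > 0" "(\<Union>x\<in>K. cball x \<rho>) \<subseteq> \<Omega>"
    using compact_subset_open_imp_cball_epsilon_subset[OF \<open>compact K\<close> \<open>open \<Omega>\<close> \<open>K \<subseteq> \<Omega>\<close>] by blast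
  have "(\<lambda>N. real CARD('n) / real N) \<longlonglongrightarrow> 0"
    by (rule lim_const_over_n)
  then have ev1: "\<forall>\<^sub>F N in sequentially. real CARD('n) / real N < \<rho>"
    using \<rho>(1) by (rule order_tendstoD)
  have "(\<lambda>N. real N powr (- (s * p))) \<longlonglongrightarrow> 0"
    by (rule tendsto_neg_powr) (use \<open>0 < s\<close> \<open>1 < p\<close> filterlim_real_sequentially in auto)
  then have "(\<lambda>N. D * real N powr (- (s * p)) * C) \<longlonglongrightarrow> D * 0 * C"
    by (intro tendsto_intros)
  then have ev2: "\<forall>\<^sub>F N in sequentially. D * real N powr (- (s * p)) * C < e / 8"
    using \<open>0 < e\<close> by (intro order_tendstoD) auto
  from eventually_happens[OF eventually_conj[OF eventually_conj[OF ev1 ev2] eventually_gt_at_top[of 0]]]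
  obtain N :: nat where N: "real CARD('n) / real N < \<rho>" "D * real N powr (- (s * p)) * C < e / 8" "N > 0"
    by auto
  have cubes: "grid_cube N (grid_index N x) \<subseteq> \<Omega>" if "x \<in> K" for x
  proof
    fix y assume "y \<in> grid_cube N (grid_index N x)"
    then have "norm (x - y) \<le> real CARD('n) / real N"
      by (intro norm_diff_grid_cube[OF N(3)]) (simp add: in_grid_cube_iff)
    then have "y \<in> cball x \<rho>" using N(1) by (simp add: dist_norm)
    then show "y \<in> \<Omega>" using \<rho>(2) that by blast
  qed
  define A where "A k x = cube_average N (v k) (grid_index N x)" for k x
  have A [measurable]: "A k \<in> borel_measurable lebesgue" for k
    unfolding A_def by (rule measurable_compose[OF measurable_grid_index]) simp
  have osc: "(\<integral>\<^sup>+x\<in>K. ennreal \<bar>v k x - A k x\<bar> \<partial>lebesgue) \<le> ennreal (e / 4)" for k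
  proof -
    have "(\<integral>\<^sup>+x\<in>K. ennreal \<bar>v k x - A k x\<bar> \<partial>lebesgue)
        \<le> ennreal \<delta> * emeasure lebesgue K + ennreal (D * real N powr (- (s * p)))
          * (\<integral>\<^sup>+y\<in>\<Omega>. (\<integral>\<^sup>+x\<in>\<Omega>. ennreal (gagliardo_kernel s p (v k) x y) \<partial>lebesgue) \<partial>lebesgue)"
      unfolding A_def D_def
      by (rule L1_dist_cube_average_le[OF v bdd N(3) K \<Omega> \<open>K \<subseteq> \<Omega>\<close> cubes \<delta>(1) \<open>1 < p\<close> \<open>0 < s\<close>])
    also have "\<dots> \<le> ennreal \<delta> * ennreal \<mu> + ennreal (D * real N powr (- (s * p))) * ennreal C"
      unfolding emK by (intro add_left_mono mult_left_mono energy) simp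
    also have "\<dots> = ennreal (\<delta> * \<mu> + D * real N powr (- (s * p)) * C)"
      using \<delta>(1) \<mu> D \<open>0 \<le> C\<close> by (simp add: ennreal_mult ennreal_plus)
    also have "\<dots> \<le> ennreal (e / 4)"
      using \<delta>(2) N(2) by (intro ennreal_leI) simp
    finally show ?thesis .
  qed
  define \<alpha> where "\<alpha> x = lim (\<lambda>k. A k x)" for x
  have A_lim: "(\<lambda>k. A k x) \<longlonglongrightarrow> \<alpha> x" for x
    using conv[of N "grid_index N x"] by (simp add: A_def \<alpha>_def convergent_LIMSEQ_iff)
  have \<alpha> [measurable]: "\<alpha> \<in> borel_measurable lebesgue"
    by (rule borel_measurable_LIMSEQ_real[OF A_lim A])
  \<comment> \<open>Dominated convergence with the indicator of \<open>K\<close>, available because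
    averages are bounded by \<open>1\<close>, makes it unnecessary to count the cubes that meet
    \<open>K\<close>.\<close>
  have "(\<lambda>k. \<integral>\<^sup>+x. norm (\<alpha> x * indicator K x - A k x * indicator K x) \<partial>lebesgue) \<longlonglongrightarrow> 0"
  proof (rule nn_integral_dominated_convergence_norm[where w = "indicator K"])
    show "AE x in lebesgue. norm (A k x * indicator K x) \<le> indicator K x" for k
      using abs_cube_average_le[OF v bdd] by (auto simp: A_def indicator_def)
    show "(\<integral>\<^sup>+x. ennreal (indicator K x) \<partial>lebesgue) < \<infinity>"
      using emK by (simp add: ennreal_indicator)
    show "AE x in lebesgue. (\<lambda>k. A k x * indicator K x) \<longlonglongrightarrow> \<alpha> x * indicator K x"
      by (intro AE_I2 tendsto_mult A_lim tendsto_const)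
  qed (measurable)
  then have "\<forall>\<^sub>F k in sequentially. (\<integral>\<^sup>+x. norm (\<alpha> x * indicator K x - A k x * indicator K x) \<partial>lebesgue) < ennreal (e / 4)"
    using \<open>0 < e\<close> by (intro order_tendstoD) auto
  then obtain n where n: "\<And>k. k \<ge> n \<Longrightarrow>
      (\<integral>\<^sup>+x. norm (\<alpha> x * indicator K x - A k x * indicator K x) \<partial>lebesgue) < ennreal (e / 4)"
    by (auto simp: eventually_sequentially)
  have close: "(\<integral>\<^sup>+x\<in>K. ennreal \<bar>\<alpha> x - A k x\<bar> \<partial>lebesgue) \<le> ennreal (e / 4)" if "k \<ge> n" for k
  proof -
    have "(\<integral>\<^sup>+x\<in>K. ennreal \<bar>\<alpha> x - A k x\<bar> \<partial>lebesgue)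
        = (\<integral>\<^sup>+x. norm (\<alpha> x * indicator K x - A k x * indicator K x) \<partial>lebesgue)"
      by (intro nn_integral_cong) (auto simp: indicator_def)
    then show ?thesis using n[OF that] by simp
  qed
  have "(\<integral>\<^sup>+x\<in>K. ennreal \<bar>v k x - v l x\<bar> \<partial>lebesgue) \<le> ennreal e" if "k \<ge> n" "l \<ge> n" for k l
  proof -
    have "(\<integral>\<^sup>+x\<in>K. ennreal \<bar>v k x - v l x\<bar> \<partial>lebesgue)
      \<le> (\<integral>\<^sup>+x. (ennreal \<bar>v k x - A k x\<bar> * indicator K x + ennreal \<bar>\<alpha> x - A k x\<bar> * indicator K x)
          + (ennreal \<bar>v l x - A l x\<bar> * indicator K x + ennreal \<bar>\<alpha> x - A l x\<bar> * indicator K x) \<partial>lebesgue)"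
      by (intro nn_integral_mono) (auto simp: indicator_def simp flip: ennreal_plus intro!: ennreal_leI)
    also have "\<dots> = ((\<integral>\<^sup>+x\<in>K. ennreal \<bar>v k x - A k x\<bar> \<partial>lebesgue) + (\<integral>\<^sup>+x\<in>K. ennreal \<bar>\<alpha> x - A k x\<bar> \<partial>lebesgue))
      + ((\<integral>\<^sup>+x\<in>K. ennreal \<bar>v l x - A l x\<bar> \<partial>lebesgue) + (\<integral>\<^sup>+x\<in>K. ennreal \<bar>\<alpha> x - A l x\<bar> \<partial>lebesgue))"
      by (simp add: nn_integral_add)
    also have "\<dots> \<le> (ennreal (e/4) + ennreal (e/4)) + (ennreal (e/4) + ennreal (e/4))"
      by (intro add_mono osc close that)
    also have "\<dots> = ennreal e"
      using \<open>0 < e\<close> by (simp flip: ennreal_plus)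
    finally show ?thesis .
  qed
  then show ?thesis by blast
qed

text \<open>Two extractions are composed: \<open>q\<close> makes all cube averages converge, and
  \<open>r\<close> turns the resulting Cauchy property on compact boxes into convergence almost
  everywhere. Countably many boxes exhaust \<Omega>.\<close>

lemma AE_convergent_subseq_of_bounded_energy:
  fixes v :: "nat \<Rightarrow> real^'n \<Rightarrow> real"
  assumes v: "\<And>k. v k \<in> borel_measurable lebesgue" and bdd: "\<And>k x. \<bar>v k x\<bar> \<le> 1"
    and "open \<Omega>" "1 < p" "0 < s" "0 \<le> C"
    and energy: "\<And>k. (\<integral>\<^sup>+y\<in>\<Omega>. (\<integral>\<^sup>+x\<in>\<Omega>. ennreal (gagliardo_kernel s p (v k) x y) \<partial>lebesgue) \<partial>lebesgue) \<le> ennreal C"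
  obtains r :: "nat \<Rightarrow> nat" where "strict_mono r"
    and "AE x in lebesgue. x \<in> \<Omega> \<longrightarrow> convergent (\<lambda>k. v (r k) x)"
proof -
  \<comment> \<open>Pairs of mesh and index form one countable set, so a single extraction for
    bounded functions on it performs the diagonal argument.\<close>
  define F where "F k Nz = cube_average (fst Nz) (v k) (snd Nz)" for k and Nz :: "nat \<times> (int^'n)"
  have "norm (F k Nz) \<le> 1" for k Nz
    unfolding F_def using abs_cube_average_le[OF v bdd] by simp
  then obtain q :: "nat \<Rightarrow> nat" where q: "strict_mono q" "\<And>Nz. Nz \<in> UNIV \<Longrightarrow> \<exists>l. (\<lambda>k. F (q k) Nz) \<longlonglongrightarrow> l"
    using function_convergent_subsequence[of UNIV F 1, OF countableI_type] by metis
  then have conv: "convergent (\<lambda>k. cube_average N (v (q k)) z)" for N z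
    using q(2)[of "(N, z)"] by (simp add: convergent_def F_def)
  obtain \<D> where \<D>: "countable \<D>" "\<D> \<subseteq> Pow \<Omega>" "\<And>X. X \<in> \<D> \<Longrightarrow> \<exists>a b. X = cbox a b" "\<Union>\<D> = \<Omega>"
    using open_countable_Union_open_cbox[OF \<open>open \<Omega>\<close>] by metis
  \<comment> \<open>Inserting the empty set keeps the family nonempty, so that it can be enumerated
    even if \<Omega> is empty.\<close>
  define K where "K = from_nat_into (insert {} \<D>)"
  have "range K = insert {} \<D>"
    unfolding K_def using \<D>(1) by (intro range_from_nat_into) auto
  then have K_in: "K j \<in> insert {} \<D>" for j
    by auto
  have K_Un: "(\<Union>j. K j) = \<Omega>"
    using \<open>range K = insert {} \<D>\<close> \<D>(4) by simp
  have K: "compact (K j)" "K j \<subseteq> \<Omega>" for j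
    using K_in[of j] \<D>(2) \<D>(3)[of "K j"] by auto
  obtain r :: "nat \<Rightarrow> nat" where r: "strict_mono r"
      "AE x in lebesgue. x \<in> (\<Union>j. K j) \<longrightarrow> convergent (\<lambda>k. v (q (r k)) x)"
  proof (rule AE_convergent_subseq_of_L1_Cauchy)
    show "v (q k) \<in> borel_measurable lebesgue" for k
      by (rule v)
    show "K j \<in> sets lebesgue" for j
      using K(1) by (auto intro: fmeasurableD[OF lmeasurable_compact])
    show "\<exists>n. \<forall>k\<ge>n. \<forall>l\<ge>n. (\<integral>\<^sup>+x\<in>K j. ennreal \<bar>v (q k) x - v (q l) x\<bar> \<partial>lebesgue) \<le> ennreal e"
      if "0 < e" for j e
      by (rule L1_Cauchy_of_bounded_energy[where \<Omega> = \<Omega> and p = p and s = s and C = C])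
        (use assms K conv that in auto)
  qed
  show thesis
  proof (rule that)
    show "strict_mono (\<lambda>k. q (r k))"
      using strict_mono_o[OF q(1) r(1)] by (simp add: o_def)
    show "AE x in lebesgue. x \<in> \<Omega> \<longrightarrow> convergent (\<lambda>k. v (q (r k)) x)"
      using r(2) by (simp only: K_Un)
  qed
qed

section \<open>Bounds extracted from the functional\<close>

lemma gagliardo_kernel_mono:
  assumes "0 \<le> p" "\<bar>v x - v y\<bar> \<le> \<bar>u x - u y\<bar>"
  shows "gagliardo_kernel s p v x y \<le> gagliardo_kernel s p u x y"
  unfolding gagliardo_kernel_def using assms
  by (intro divide_right_mono powr_mono2) auto

lemma ennreal_le_of_mult_le:
  assumes "ennreal a * x \<le> ennreal b" "0 < a"
  shows "x \<le> ennreal (b / a)"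
proof -
  have "ennreal (1 / a) * (ennreal a * x) \<le> ennreal (1 / a) * ennreal b"
    by (rule mult_left_mono[OF assms(1)]) simp
  moreover have "ennreal (1 / a) * (ennreal a * x) = x"
    using \<open>0 < a\<close> by (simp flip: mult.assoc ennreal_mult)
  moreover have "ennreal (1 / a) * ennreal b = ennreal (b / a)"
    using \<open>0 < a\<close> by (simp flip: ennreal_mult')
  ultimately show ?thesis by simp
qed

text \<open>All terms of the functional are nonnegative, so each is bounded by the total. The factor
  \<open>2\<close> undoes the \<open>1/2\<close> in \<open>K_energy\<close>, and
  \<open>\<epsilon> powr (s * p)\<close> undoes the weight of the potential.\<close>

lemma F_energy_le_imp:
  assumes "F_energy W s p \<epsilon> \<Omega> u \<le> ennreal B" "0 < \<epsilon>"
  shows "(\<integral>\<^sup>+y\<in>\<Omega>. (\<integral>\<^sup>+x\<in>\<Omega>. ennreal (gagliardo_kernel s p u x y) \<partial>lebesgue) \<partial>lebesgue) \<le> ennreal (2 * B)"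
    and "(\<integral>\<^sup>+x\<in>\<Omega>. ennreal (W (u x)) \<partial>lebesgue) \<le> ennreal (B * \<epsilon> powr (s * p))"
proof -
  let ?I = "\<integral>\<^sup>+y\<in>\<Omega>. (\<integral>\<^sup>+x\<in>\<Omega>. ennreal (gagliardo_kernel s p u x y) \<partial>lebesgue) \<partial>lebesgue"
  let ?J = "\<integral>\<^sup>+x\<in>\<Omega>. ennreal (W (u x)) \<partial>lebesgue"
  have "1 / 2 * ?I \<le> F_energy W s p \<epsilon> \<Omega> u"
    unfolding F_energy_def K_energy_def add.assoc by (rule add_increasing2) auto
  then have I: "1 / 2 * ?I \<le> ennreal B"
    using assms(1) by (rule order_trans)
  have half: "(1 / 2 :: ennreal) = ennreal (1 / 2)"
    using divide_ennreal[of 1 2] by simp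
  show "?I \<le> ennreal (2 * B)"
    using ennreal_le_of_mult_le[OF I[unfolded half]] by (simp add: mult.commute)
  have "ennreal (\<epsilon> powr (- (s * p))) * ?J \<le> F_energy W s p \<epsilon> \<Omega> u"
    unfolding F_energy_def by (rule add_increasing) auto
  then have "ennreal (\<epsilon> powr (- (s * p))) * ?J \<le> ennreal B"
    using assms(1) by (rule order_trans)
  from ennreal_le_of_mult_le[OF this] \<open>0 < \<epsilon>\<close>
  show "?J \<le> ennreal (B * \<epsilon> powr (s * p))"
    by (simp add: powr_minus_divide)
qed

section \<open>The convergent subsequence and its two-valued limit\<close>

theorem theorem1p6:
  fixes \<Omega> :: "(real^'n) set"
    and p s m c\<^sub>2 c\<^sub>3 :: real
    and W :: "real \<Rightarrow> real"
    and u :: "real \<Rightarrow> real^'n \<Rightarrow> real"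
  assumes "open \<Omega>"
    and "1 < p"
    and "0 < s" and "s < 1 / p"
    and "p \<le> m"
    and "standing_potential m W"
    and "0 < c\<^sub>2" and "0 < c\<^sub>3"
    and "\<And>x. x \<in> {-1<..<1} \<Longrightarrow>
           c\<^sub>3 * (1 - x\<^sup>2) powr m \<ge> W x \<and> W x \<ge> c\<^sub>2 * (1 - x\<^sup>2) powr m"
    and "\<And>\<epsilon>. \<epsilon> \<in> {0<..<1} \<Longrightarrow> u \<epsilon> \<in> X_space s p \<Omega>"
    and "(SUP \<epsilon>\<in>{0<..<1}. F_energy W s p \<epsilon> \<Omega> (u \<epsilon>)) < \<infinity>"
  shows "\<exists>E\<in>sets lebesgue. \<exists>\<epsilon> :: nat \<Rightarrow> real.
           (\<forall>k. \<epsilon> k \<in> {0<..<1}) \<and> \<epsilon> \<longlonglongrightarrow> 0 \<and>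
           tendsto_L1_loc \<Omega> (\<lambda>k. u (\<epsilon> k)) (\<lambda>x. indicator E x - indicator (- E) x)"
proof -
  obtain B where B: "0 \<le> B" "(SUP \<epsilon>\<in>{0<..<1}. F_energy W s p \<epsilon> \<Omega> (u \<epsilon>)) = ennreal B"
    using assms(11) by (auto simp: less_top_ennreal)
  have F: "F_energy W s p \<epsilon> \<Omega> (u \<epsilon>) \<le> ennreal B" if "\<epsilon> \<in> {0<..<1}" for \<epsilon>
    unfolding B(2)[symmetric] using that by (rule SUP_upper)
  \<comment> \<open>A geometric sequence makes the potential energies summable.\<close>
  define e where "e k = (1/2 :: real) ^ Suc k" for k
  have e: "e k \<in> {0<..<1}" for k
    by (simp add: e_def power_Suc_less_one del: power_Suc)
  have e_lim: "e \<longlonglongrightarrow> 0"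
    unfolding e_def by (intro LIMSEQ_Suc LIMSEQ_power_zero) simp
  have u [measurable]: "u (e k) \<in> borel_measurable lebesgue" for k
    using assms(10)[OF e] by (simp add: X_space_def)
  have u1: "AE x in lebesgue. \<bar>u (e k) x\<bar> \<le> 1" for k
  proof -
    have "esssup lebesgue (\<lambda>x. ereal \<bar>u (e k) x\<bar>) \<le> 1"
      using assms(10)[OF e] by (simp add: X_space_def)
    then show ?thesis
      using esssup_AE[of "\<lambda>x. ereal \<bar>u (e k) x\<bar>" lebesgue]
      by (auto elim!: eventually_mono dest: order_trans simp flip: one_ereal_def)
  qed
  \<comment> \<open>Truncation does not increase the kernel and turns the essential bound into a pointwise one.\<close>
  define v where "v k x = max (- 1) (min 1 (u (e k) x))" for k x
  have v [measurable]: "v k \<in> borel_measurable lebesgue" for k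
    unfolding v_def by measurable
  have v1: "\<bar>v k x\<bar> \<le> 1" for k x
    by (simp add: v_def)
  have vu: "AE x in lebesgue. \<forall>k. v k x = u (e k) x"
    unfolding AE_all_countable
  proof
    show "AE x in lebesgue. v k x = u (e k) x" for k
      using u1[of k] by eventually_elim (auto simp: v_def)
  qed
  have energy: "(\<integral>\<^sup>+y\<in>\<Omega>. (\<integral>\<^sup>+x\<in>\<Omega>. ennreal (gagliardo_kernel s p (v k) x y) \<partial>lebesgue) \<partial>lebesgue)
      \<le> ennreal (2 * B)" for k
  proof (rule order_trans[OF _ F_energy_le_imp(1)[OF F[OF e[of k]]]])
    have "gagliardo_kernel s p (v k) x y \<le> gagliardo_kernel s p (u (e k)) x y" for x y
      using \<open>1 < p\<close> by (intro gagliardo_kernel_mono) (auto simp: v_def)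
    then show "(\<integral>\<^sup>+y\<in>\<Omega>. (\<integral>\<^sup>+x\<in>\<Omega>. ennreal (gagliardo_kernel s p (v k) x y) \<partial>lebesgue) \<partial>lebesgue)
        \<le> (\<integral>\<^sup>+y\<in>\<Omega>. (\<integral>\<^sup>+x\<in>\<Omega>. ennreal (gagliardo_kernel s p (u (e k)) x y) \<partial>lebesgue) \<partial>lebesgue)"
      by (intro nn_integral_mono mult_right_mono ennreal_leI) auto
    show "0 < e k" using e[of k] by simp
  qed
  obtain r :: "nat \<Rightarrow> nat" where r: "strict_mono r"
      "AE x in lebesgue. x \<in> \<Omega> \<longrightarrow> convergent (\<lambda>k. v (r k) x)"
    by (rule AE_convergent_subseq_of_bounded_energy[OF v v1 \<open>open \<Omega>\<close> \<open>1 < p\<close> \<open>0 < s\<close> _ energy])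
      (use B(1) in auto)
  define g where "g t = (1 - t\<^sup>2) powr m" for t :: real
  have m: "m > 0" using \<open>1 < p\<close> \<open>p \<le> m\<close> by simp
  \<comment> \<open>The two-sided bound is given on the open interval only. At \<open>1\<close> and
    \<open>-1\<close> the function \<open>g\<close> vanishes, and nonnegativity of \<open>W\<close>
    on the closed interval suffices.\<close>
  have gW: "c\<^sub>2 * g t \<le> W t" if "\<bar>t\<bar> \<le> 1" for t
  proof (cases "\<bar>t\<bar> = 1")
    case True
    then have "g t = 0" by (auto simp: g_def abs_if split: if_splits)
    then show ?thesis
      using that assms(6) by (simp add: standing_potential_def abs_le_iff)
  next
    case False
    then show ?thesis using that assms(9)[of t] by (auto simp: g_def abs_if split: if_splits)
  qed
  \<comment> \<open>Summability yields \<open>g (v k x)\<close> tending to \<open>0\<close> for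
    almost every \<open>x\<close> of \<Omega> along the whole sequence \<open>e\<close>, so no
    further extraction is needed.\<close>
  have "AE x in lebesgue. summable (\<lambda>k. c\<^sub>2 * g (v k x) * indicator \<Omega> x)"
  proof (rule AE_summable_of_nn_integral_le)
    have [measurable]: "\<Omega> \<in> sets lebesgue" using \<open>open \<Omega>\<close> by auto
    show "(\<lambda>x. c\<^sub>2 * g (v k x) * indicator \<Omega> x) \<in> borel_measurable lebesgue" for k
      unfolding g_def by measurable
    show "0 \<le> c\<^sub>2 * g (v k x) * indicator \<Omega> x" for k x
      using \<open>0 < c\<^sub>2\<close> by (simp add: g_def)
    show "(\<integral>\<^sup>+x. ennreal (c\<^sub>2 * g (v k x) * indicator \<Omega> x) \<partial>lebesgue)
        \<le> ennreal (B * ((1/2) powr (s * p)) ^ Suc k)" for k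
    proof -
      have "(\<integral>\<^sup>+x. ennreal (c\<^sub>2 * g (v k x) * indicator \<Omega> x) \<partial>lebesgue)
          \<le> (\<integral>\<^sup>+x\<in>\<Omega>. ennreal (W (u (e k) x)) \<partial>lebesgue)"
      proof (rule nn_integral_mono_AE)
        show "AE x in lebesgue. ennreal (c\<^sub>2 * g (v k x) * indicator \<Omega> x)
            \<le> ennreal (W (u (e k) x)) * indicator \<Omega> x"
          using vu
        proof eventually_elim
          case (elim x)
          then have "c\<^sub>2 * g (v k x) \<le> W (u (e k) x)"
            using gW[OF v1[of k x]] by simp
          then show ?case
            by (auto simp: indicator_def intro!: ennreal_leI)
        qed
      qed
      also have "\<dots> \<le> ennreal (B * e k powr (s * p))"
        using F_energy_le_imp(2)[OF F[OF e[of k]]] e[of k] by simp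
      \<comment> \<open>Swapping the two exponents exhibits the bound as a geometric sequence in
        \<open>k\<close>.\<close>
      also have "e k powr (s * p) = ((1/2) powr (s * p)) ^ Suc k"
        unfolding e_def powr_realpow[symmetric, of "1/2" "Suc k", simplified]
        by (simp add: powr_powr mult.commute flip: powr_realpow del: power_Suc)
      finally show ?thesis .
    qed
    have "(1/2::real) powr (s * p) < 1"
      using \<open>0 < s\<close> \<open>1 < p\<close> powr_less_mono2[of "s * p" "1/2" 1] by simp
    then show "summable (\<lambda>k. B * ((1/2) powr (s * p)) ^ Suc k)"
      by (intro summable_mult) (simp only: summable_Suc_iff, simp add: summable_geometric)
  qed (use B(1) in auto)
  then have well: "AE x in lebesgue. x \<in> \<Omega> \<longrightarrow> (\<lambda>k. g (v k x)) \<longlonglongrightarrow> 0"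
  proof eventually_elim
    case (elim x)
    show ?case
    proof
      assume "x \<in> \<Omega>"
      then have "(\<lambda>k. c\<^sub>2 * g (v k x)) \<longlonglongrightarrow> 0"
        using summable_LIMSEQ_zero[OF elim] by simp
      then have "(\<lambda>k. inverse c\<^sub>2 * (c\<^sub>2 * g (v k x))) \<longlonglongrightarrow> inverse c\<^sub>2 * 0"
        by (intro tendsto_intros)
      then show "(\<lambda>k. g (v k x)) \<longlonglongrightarrow> 0"
        using \<open>0 < c\<^sub>2\<close> by simp
    qed
  qed
  \<comment> \<open>Where the sequence diverges, \<open>lim\<close> is an unspecified value. Within
    \<Omega> this concerns a null set only, outside \<Omega> the set is unconstrained, and
    measurability of \<open>lim\<close> holds regardless.\<close>
  define E where "E = {x. 0 < lim (\<lambda>k. v (r k) x)}"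
  have E [measurable]: "E \<in> sets lebesgue"
  proof -
    have "(\<lambda>x. lim (\<lambda>k. v (r k) x)) \<in> borel_measurable lebesgue"
      by (rule borel_measurable_lim_metric) (rule v)
    then have "{x \<in> space lebesgue. 0 < lim (\<lambda>k. v (r k) x)} \<in> sets lebesgue"
      by measurable
    then show ?thesis by (simp add: E_def)
  qed
  define w :: "real^'n \<Rightarrow> real" where "w x = indicator E x - indicator (- E) x" for x
  have w [measurable]: "w \<in> borel_measurable lebesgue"
    unfolding w_def by measurable
  have w1: "\<bar>w x\<bar> \<le> 1" for x
    by (auto simp: w_def indicator_def)
  have lim: "AE x in lebesgue. x \<in> \<Omega> \<longrightarrow> (\<lambda>k. u (e (r k)) x) \<longlonglongrightarrow> w x"
    using r(2) well vu
  proof eventually_elim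
    case (elim x)
    show ?case
    proof
      assume "x \<in> \<Omega>"
      define L where "L = lim (\<lambda>k. v (r k) x)"
      have L: "(\<lambda>k. v (r k) x) \<longlonglongrightarrow> L"
        using elim(1) \<open>x \<in> \<Omega>\<close> by (simp add: L_def convergent_LIMSEQ_iff)
      have "(\<lambda>k. \<bar>v (r k) x\<bar>) \<longlonglongrightarrow> \<bar>L\<bar>"
        by (intro tendsto_intros L)
      then have L1: "\<bar>L\<bar> \<le> 1"
        by (rule LIMSEQ_le_const2) (use v1 in auto)
      have "(\<lambda>k. g (v (r k) x)) \<longlonglongrightarrow> g L"
        unfolding g_def
        \<comment> \<open>The base \<open>1 - L\<^sup>2\<close> may be \<open>0\<close>, so
          continuity of the power relies on nonnegative bases and on \<open>m > 0\<close>.\<close>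
        by (rule tendsto_powr2) (use L m v1 in \<open>auto intro!: tendsto_intros simp: abs_square_le_1\<close>)
      moreover have "(\<lambda>k. g (v (r k) x)) \<longlonglongrightarrow> 0"
        using LIMSEQ_subseq_LIMSEQ[OF _ r(1), of "\<lambda>k. g (v k x)" 0] elim(2) \<open>x \<in> \<Omega>\<close> by (simp add: o_def)
      ultimately have "g L = 0"
        by (rule LIMSEQ_unique)
      \<comment> \<open>A real power vanishes only if its base does. The sign of \<open>L\<close>
        then decides membership in \<open>E\<close>, so \<open>w x\<close> agrees with
        \<open>L\<close>.\<close>
      then have "L = 1 \<or> L = -1"
        by (auto simp: g_def power2_eq_1_iff)
      then have "w x = L"
        unfolding w_def E_def by (auto simp: indicator_def L_def)
      then show "(\<lambda>k. u (e (r k)) x) \<longlonglongrightarrow> w x"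
        using L elim(3) by simp
    qed
  qed
  have "tendsto_L1_loc \<Omega> (\<lambda>k. u (e (r k))) w"
    unfolding tendsto_L1_loc_def L1_loc_def
  proof (intro conjI allI impI CollectI; (elim conjE)?)
    fix C :: "(real^'n) set" assume C: "compact C" "C \<subseteq> \<Omega>"
    have [measurable]: "C \<in> sets lebesgue" and fin: "emeasure lebesgue C < \<infinity>"
      using lmeasurable_compact[OF C(1)] by (auto simp: fmeasurable_def simp del: emeasure_completion)
    show "set_integrable lebesgue C (u (e (r k)))" for k
      by (rule set_integrable_lebesgue_bounded[OF u u1]) (use fin in auto)
    show "set_integrable lebesgue C w"
      by (rule set_integrable_lebesgue_bounded[OF w, where B = 1]) (use fin w1 in auto)
    \<comment> \<open>Both functions are bounded by \<open>1\<close> almost everywhere, so twice the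
      indicator of \<open>C\<close> dominates and pointwise convergence passes to the
      integrals.\<close>
    have "(\<lambda>k. LINT x|lebesgue. indicator C x *\<^sub>R \<bar>u (e (r k)) x - w x\<bar>) \<longlonglongrightarrow> (LINT x|(lebesgue :: (real^'n) measure). (0::real))"
    proof (rule integral_dominated_convergence[where w = "\<lambda>x. 2 * indicator C x"])
      show "integrable lebesgue (\<lambda>x. 2 * indicator C x :: real)"
        using fin by auto
      show "AE x in lebesgue. (\<lambda>k. indicator C x *\<^sub>R \<bar>u (e (r k)) x - w x\<bar>) \<longlonglongrightarrow> 0"
        using lim
      proof eventually_elim
        case (elim x)
        show ?case
        proof (cases "x \<in> C")
          case True
          then have "(\<lambda>k. u (e (r k)) x) \<longlonglongrightarrow> w x"
            using elim C(2) by auto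
          then have "(\<lambda>k. \<bar>u (e (r k)) x - w x\<bar>) \<longlonglongrightarrow> \<bar>w x - w x\<bar>"
            by (intro tendsto_intros)
          then show ?thesis using True by simp
        qed simp
      qed
      show "AE x in lebesgue. norm (indicator C x *\<^sub>R \<bar>u (e (r k)) x - w x\<bar>) \<le> 2 * indicator C x" for k
        using u1[of "r k"]
      proof eventually_elim
        case (elim x)
        then show ?case using w1[of x] by (auto simp: indicator_def)
      qed
    qed measurable
    then show "(\<lambda>k. LINT x:C|lebesgue. \<bar>u (e (r k)) x - w x\<bar>) \<longlonglongrightarrow> 0"
      by (simp add: set_lebesgue_integral_def)
  qed
  moreover have "(\<lambda>k. e (r k)) \<longlonglongrightarrow> 0"
    using LIMSEQ_subseq_LIMSEQ[OF e_lim r(1)] by (simp add: o_def)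
  ultimately show ?thesis
    using E e unfolding w_def by (intro bexI[of _ E] exI[of _ "\<lambda>k. e (r k)"]) auto
qed

end
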